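(* There exist an increasing sequence of natural numbers $(r_n)_{n\in\mathbb{N}}$ and a $1$-correlation $(a(n))_{n\in\mathbb{N}}$ such that for any almost periodic sequence $(\psi(n))_{n\in\mathbb{N}}$, $$\liminf_{N\to\infty} \frac{1}{N} \sum_{n=1}^N |a(r_n) - \psi(r_n)| > 0.$$
   Context: $\mathbb{N} = \{1,2,3,\ldots\}$. A $1$-correlation is a sequence of the form $a(n) = \int_X f_0(x) f_1(T^n x)\, d\mu(x)$, where $(X,\mathcal{B},\mu,T)$ is a measure preserving system (with $\mu$ a probability measure) and $f_0, f_1$ are bounded measurable functions on $X$. An almost periodic sequence is a uniform limit of $1$-step nilsequences on $\mathbb{N}$; equivalently, it is a complex sequence $(\psi(n))_{n\in\mathbb{N}}$ that is a uniform limit (over $n \in \mathbb{N}$) of trigonometric polynomials, i.e. of sequences of the form $n \mapsto \sum_{j=1}^M c_j e^{2\pi i n \alpha_j}$ with $c_j \in \mathbb{C}$, $\alpha_j \in \mathbb{R}/\mathbb{Z}$. *)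

theory Defs
  imports "HOL-Probability.Probability"
begin

text \<open>Sequences over \<open>{1, 2, 3, ...}\<close> are functions on \<^typ>\<open>nat\<close> whose value at \<open>0\<close> is
  disregarded.\<close>

definition measure_preserving_system :: "'x measure \<Rightarrow> ('x \<Rightarrow> 'x) \<Rightarrow> bool" where
  "measure_preserving_system M T \<longleftrightarrow>
     prob_space M \<and> T \<in> measurable M M \<and>
     (\<forall>A\<in>sets M. emeasure M (T -` A \<inter> space M) = emeasure M A)"

text \<open>HOL cannot quantify over types inside a formula, so the type in which the underlying set of
  the system lives is a parameter. The set itself (\<open>space M\<close>) and its sigma-algebra are arbitrary.
  Taking \<^typ>\<open>real\<close> for the type loses no generality: a 1-correlation involves only the countably many
  functions \<open>f0 \<circ> T ^^ n\<close> and \<open>f1 \<circ> T ^^ n\<close>, so it can be realised by the shift on a countable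
  product of copies of \<^typ>\<open>complex\<close>, a space in bijection with \<^typ>\<open>real\<close>.\<close>

definition one_correlation :: "'x itself \<Rightarrow> (nat \<Rightarrow> complex) \<Rightarrow> bool" where
  "one_correlation _ a \<longleftrightarrow>
     (\<exists>(M :: 'x measure) T f0 f1.
        measure_preserving_system M T \<and>
        f0 \<in> borel_measurable M \<and> bounded (f0 ` space M) \<and>
        f1 \<in> borel_measurable M \<and> bounded (f1 ` space M) \<and>
        (\<forall>n\<ge>1. a n = (\<integral>x. f0 x * f1 ((T ^^ n) x) \<partial>M)))"

definition trig_polynomial :: "(nat \<Rightarrow> complex) \<Rightarrow> bool" where
  "trig_polynomial p \<longleftrightarrow>
     (\<exists>(m :: nat) (c :: nat \<Rightarrow> complex) (\<alpha> :: nat \<Rightarrow> real).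
        \<forall>n. p n = (\<Sum>j=1..m. c j * exp (2 * of_real pi * \<i> * of_nat n * of_real (\<alpha> j))))"

definition almost_periodic :: "(nat \<Rightarrow> complex) \<Rightarrow> bool" where
  "almost_periodic \<psi> \<longleftrightarrow>
     (\<exists>p. (\<forall>k. trig_polynomial (p k)) \<and> uniform_limit {1..} p \<psi> sequentially)"

end

theory Submission
  imports Defs
begin

text \<open>The correlation is the Fourier transform \<open>a n = \<integral> phase (n * t)\<close>, where
  \<open>phase x = exp (2 \<pi> \<i> x)\<close>, of the Cantor measure of numbers \<open>t\<close> whose base-\<open>4\<close> digits are
  independent fair bits. Self-similarity of this measure (\<open>cantor_fourier_scaling\<close>) gives
  \<open>a (4 * n) = a n\<close> for integers \<open>n\<close> and makes \<open>a\<close> vanish at every \<open>n\<close> congruent to \<open>2\<close> modulo \<open>4\<close>.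
  Put \<open>d i = 2 * 4 ^ i\<close>. Then \<open>a\<close> takes one and the same nonzero value \<open>c\<close> at all powers of \<open>4\<close>, but
  \<open>a (4 ^ k + d j - d i) = 0\<close> whenever \<open>i < j\<close> and \<open>i < k\<close>.

  An almost periodic sequence cannot imitate this. Let \<open>\<psi>\<close> be approximated within \<open>\<bar>c\<bar>/6\<close> by a
  trigonometric polynomial \<open>p\<close>. By the pigeonhole principle, every sufficiently long window of
  indices contains some \<open>i < j\<close> for which \<open>d i\<close> and \<open>d j\<close> look almost the same to all frequencies of
  \<open>p\<close> (\<open>trig_polynomial_increment\<close>), and then a shift by \<open>d j - d i\<close> hardly changes \<open>p\<close>, wherever it
  starts. Hence \<open>\<psi>\<close> is nearly equal at \<open>4 ^ k\<close> and at \<open>4 ^ k + d j - d i\<close>, while \<open>a\<close> differs by \<open>c\<close>,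
  so \<open>a - \<psi>\<close> is not small at one of the two times.

  It remains to run through all pairs \<open>i < j\<close>, using a new power of \<open>4\<close> for each, in an order for
  which one good pair per window amounts to a positive proportion of all pairs
  (\<open>good_pairs_positive_density\<close>). The proportion depends on \<open>\<psi>\<close>, which is harmless, since only
  positivity of the lower limit is claimed.

  The Fourier transform of any probability measure on the line is a 1-correlation: rotate the
  circle over the point \<open>t\<close> by the angle \<open>t\<close> (\<open>one_correlation_fourier_coefficients\<close>). This system
  lives on pairs of reals and is moved to the reals by a set-theoretic injection
  (\<open>one_correlation_transfer\<close>).\<close>

section \<open>Fourier coefficients as correlations\<close>

definition phase :: "real \<Rightarrow> complex" where
  "phase x = cis (2 * pi * x)"

lemma phase_0 [simp]: "phase 0 = 1" by (simp add: phase_def)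
lemma norm_phase [simp]: "cmod (phase x) = 1" by (simp add: phase_def)
lemma phase_add: "phase (x + y) = phase x * phase y" by (simp add: phase_def cis_mult ring_distribs)
lemma phase_of_int [simp]: "phase (of_int k) = 1"
  using cis_multiple_2pi[of "of_int k"] by (simp add: phase_def)
lemma phase_of_nat [simp]: "phase (of_nat k) = 1"
  using phase_of_int[of "int k"] by simp
lemma phase_frac [simp]: "phase (frac x) = phase x"
proof -
  have "phase x = phase (frac x + of_int \<lfloor>x\<rfloor>)" by (simp add: frac_def)
  then show ?thesis by (simp only: phase_add phase_of_int mult_1_right)
qed
lemma measurable_phase [measurable]: "phase \<in> borel_measurable borel"
  unfolding phase_def cis_conv_exp by measurable

lemma emeasure_lborel_translate:
  fixes c :: real
  assumes [measurable]: "B \<in> sets borel"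
  shows "emeasure lborel {y. y + c \<in> B} = emeasure lborel B"
proof -
  have "emeasure lborel B = emeasure (distr lborel borel ((+) c)) B"
    by (simp add: lborel_distr_plus)
  also have "\<dots> = emeasure lborel {y. y + c \<in> B}"
    by (subst emeasure_distr) (auto simp: vimage_def add.commute)
  finally show ?thesis by simp
qed

text \<open>With \<open>u\<close> the fractional part of \<open>s\<close>, rotation by \<open>s\<close> moves \<open>[0, 1 - u)\<close> and \<open>[1 - u, 1)\<close> onto
  \<open>[u, 1)\<close> and \<open>[0, u)\<close> by two translations, each of which preserves Lebesgue measure.\<close>
lemma emeasure_rotation:
  fixes s :: real
  assumes B [measurable]: "B \<in> sets borel"
  shows "emeasure lborel ({0..<1} \<inter> {y. frac (y + s) \<in> B}) = emeasure lborel ({0..<1} \<inter> B)"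
proof -
  define u where "u = frac s"
  have u: "0 \<le> u" "u < 1" by (auto simp: u_def frac_lt_1)
  have frac_eq: "frac (y + s) = (if y < 1 - u then y + u else y + (u - 1))" if "0 \<le> y" "y < 1" for y
  proof -
    have "frac (y + s) = frac (frac y + frac s)" by (simp add: frac_def floor_add)
    then show ?thesis using that u frac_add[of y s]
      by (auto simp: u_def frac_eq[of y, THEN iffD2])
  qed
  have "{0..<1} \<inter> {y. frac (y + s) \<in> B} =
      {y. y + u \<in> B \<inter> {u..<1}} \<union> {y. y + (u - 1) \<in> B \<inter> {0..<u}}"
    using u by (auto simp: frac_eq split: if_splits)
  then have "emeasure lborel ({0..<1} \<inter> {y. frac (y + s) \<in> B}) =
      emeasure lborel {y. y + u \<in> B \<inter> {u..<1}} + emeasure lborel {y. y + (u - 1) \<in> B \<inter> {0..<u}}"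
    by (simp add: plus_emeasure disjoint_iff)
  also have "\<dots> = emeasure lborel (B \<inter> {u..<1}) + emeasure lborel (B \<inter> {0..<u})"
    by (subst (1 2) emeasure_lborel_translate) auto
  also have "\<dots> = emeasure lborel ((B \<inter> {u..<1}) \<union> (B \<inter> {0..<u}))"
    by (subst plus_emeasure) (auto simp: disjoint_iff)
  also have "(B \<inter> {u..<1}) \<union> (B \<inter> {0..<u}) = {0..<1} \<inter> B" using u by auto
  finally show ?thesis .
qed

text \<open>The system is the skew product \<open>(t, y) \<mapsto> (t, y + t mod 1)\<close>, which rotates the circle over \<open>t\<close>
  by \<open>t\<close>. Over \<open>t\<close> the character \<open>y \<mapsto> phase y\<close> is an eigenfunction with eigenvalue \<open>phase t\<close>, so
  pairing it with its conjugate produces \<open>phase (n * t)\<close>, to be averaged over \<open>t\<close>.\<close>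
lemma one_correlation_fourier_coefficients:
  fixes \<sigma> :: "real measure"
  assumes "prob_space \<sigma>" and sets_\<sigma> [measurable_cong]: "sets \<sigma> = sets borel"
  shows "one_correlation TYPE(real \<times> real) (\<lambda>n. \<integral>t. phase (of_nat n * t) \<partial>\<sigma>)"
proof -
  interpret \<sigma>: prob_space \<sigma> by fact
  define U where "U = uniform_measure lborel {0..<1::real}"
  have U_sets [measurable_cong]: "sets U = sets borel" by (simp add: U_def)
  interpret U: prob_space U unfolding U_def by (rule prob_space_uniform_measure) auto
  interpret P: pair_prob_space \<sigma> U ..
  define T :: "real \<times> real \<Rightarrow> real \<times> real" where "T = (\<lambda>(t, y). (t, frac (y + t)))"
  define f1 where "f1 = (\<lambda>(t::real, y). phase y)"
  define f0 where "f0 = (\<lambda>(t::real, y). phase (- y))"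
  have frac_meas [measurable]: "frac \<in> borel_measurable (borel :: real measure)"
    unfolding frac_def by measurable
  have T_meas [measurable]: "T \<in> measurable (\<sigma> \<Otimes>\<^sub>M U) (\<sigma> \<Otimes>\<^sub>M U)"
    unfolding T_def by measurable
  have U_rot: "emeasure U {y. frac (y + s) \<in> B} = emeasure U B" if [measurable]: "B \<in> sets borel" for B s
    using emeasure_rotation[OF that, of s] by (simp add: U_def)
  have mp: "emeasure (\<sigma> \<Otimes>\<^sub>M U) (T -` A \<inter> space (\<sigma> \<Otimes>\<^sub>M U)) = emeasure (\<sigma> \<Otimes>\<^sub>M U) A"
    if A [measurable]: "A \<in> sets (\<sigma> \<Otimes>\<^sub>M U)" for A
  proof -
    have "emeasure (\<sigma> \<Otimes>\<^sub>M U) (T -` A \<inter> space (\<sigma> \<Otimes>\<^sub>M U))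
        = (\<integral>\<^sup>+t. emeasure U (Pair t -` (T -` A \<inter> space (\<sigma> \<Otimes>\<^sub>M U))) \<partial>\<sigma>)"
      by (rule U.emeasure_pair_measure_alt) measurable
    also have "\<dots> = (\<integral>\<^sup>+t. emeasure U (Pair t -` A) \<partial>\<sigma>)"
    proof (rule nn_integral_cong)
      fix t assume "t \<in> space \<sigma>"
      have "Pair t -` (T -` A \<inter> space (\<sigma> \<Otimes>\<^sub>M U)) = {y. frac (y + t) \<in> Pair t -` A}"
        using \<open>t \<in> space \<sigma>\<close> sets_eq_imp_space_eq[OF U_sets]
        by (auto simp: T_def space_pair_measure)
      moreover have "Pair t -` A \<in> sets borel"
        using sets_Pair1[OF A] U_sets by simp
      ultimately show "emeasure U (Pair t -` (T -` A \<inter> space (\<sigma> \<Otimes>\<^sub>M U))) = emeasure U (Pair t -` A)"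
        using U_rot[of "Pair t -` A" t] by (simp only:)
    qed
    also have "\<dots> = emeasure (\<sigma> \<Otimes>\<^sub>M U) A"
      by (rule U.emeasure_pair_measure_alt[symmetric]) fact
    finally show ?thesis .
  qed
  have f1_iter: "f1 ((T ^^ n) z) = phase (of_nat n * fst z) * f1 z" for n z
  proof (induction n arbitrary: z)
    case (Suc n)
    have "f1 ((T ^^ Suc n) z) = phase (of_nat n * fst (T z)) * f1 (T z)"
      by (simp add: funpow_Suc_right Suc.IH del: funpow.simps)
    also have "\<dots> = phase (of_nat (Suc n) * fst z) * f1 z"
      by (cases z) (simp add: T_def f1_def phase_add ring_distribs)
    finally show ?case .
  qed simp
  have corr: "(\<integral>t. phase (of_nat n * t) \<partial>\<sigma>) = (\<integral>z. f0 z * f1 ((T ^^ n) z) \<partial>(\<sigma> \<Otimes>\<^sub>M U))" for n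
  proof -
    have "f0 z * f1 ((T ^^ n) z) = phase (of_nat n * fst z)" for z
      unfolding f1_iter by (cases z) (simp add: f0_def f1_def phase_add[symmetric])
    moreover have "(\<integral>z. phase (of_nat n * fst z) \<partial>(\<sigma> \<Otimes>\<^sub>M U)) = (\<integral>t. phase (of_nat n * t) \<partial>\<sigma>)"
    proof -
      have "integrable (\<sigma> \<Otimes>\<^sub>M U) (\<lambda>z. phase (of_nat n * fst z))"
        by (rule P.P.integrable_const_bound[where B = 1]) auto
      from P.integral_fst'[OF this] show ?thesis by (simp add: U.prob_space)
    qed
    ultimately show ?thesis by simp
  qed
  have "measure_preserving_system (\<sigma> \<Otimes>\<^sub>M U) T"
    unfolding measure_preserving_system_def using P.P.prob_space_axioms mp by simp
  moreover have "f0 \<in> borel_measurable (\<sigma> \<Otimes>\<^sub>M U)" "f1 \<in> borel_measurable (\<sigma> \<Otimes>\<^sub>M U)"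
    unfolding f0_def f1_def by measurable
  moreover have "bounded (f0 ` space (\<sigma> \<Otimes>\<^sub>M U))" "bounded (f1 ` space (\<sigma> \<Otimes>\<^sub>M U))"
    unfolding bounded_iff by (auto intro!: exI[of _ 1] simp: f0_def f1_def)
  ultimately show ?thesis unfolding one_correlation_def using corr by blast
qed

text \<open>Since a system may carry any \<open>\<sigma>\<close>-algebra, it can be carried along an injection that has no
  measurability property whatsoever, by transporting its \<open>\<sigma>\<close>-algebra as well.\<close>
lemma one_correlation_transfer:
  fixes h :: "'x \<Rightarrow> 'y"
  assumes "inj h" and "one_correlation TYPE('x) a"
  shows "one_correlation TYPE('y) a"
proof -
  from assms(2) obtain M :: "'x measure" and T f0 f1 where
    mps: "measure_preserving_system M T"
    and f0 [measurable]: "f0 \<in> borel_measurable M" and b0: "bounded (f0 ` space M)"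
    and f1 [measurable]: "f1 \<in> borel_measurable M" and b1: "bounded (f1 ` space M)"
    and a: "\<forall>n\<ge>1. a n = (\<integral>x. f0 x * f1 ((T ^^ n) x) \<partial>M)"
    unfolding one_correlation_def by blast
  have T [measurable]: "T \<in> measurable M M" and prob: "prob_space M"
    and mp: "\<And>A. A \<in> sets M \<Longrightarrow> emeasure M (T -` A \<inter> space M) = emeasure M A"
    using mps by (auto simp: measure_preserving_system_def)
  define M' where "M' = embed_measure M h"
  define T' where "T' = h \<circ> T \<circ> inv h"
  have inv [simp]: "inv h (h x) = x" for x using \<open>inj h\<close> by simp
  have h [measurable]: "h \<in> measurable M M'"
    unfolding M'_def by (rule measurable_embed_measure2) fact
  have distr: "M' = distr M M' h"
    unfolding M'_def by (rule embed_measure_eq_distr) fact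
  have invh: "inv h \<in> measurable M' M"
    unfolding M'_def by (rule measurable_embed_measure1) simp
  have T': "T' \<in> measurable M' M'"
    unfolding T'_def by (rule measurable_comp[OF invh measurable_comp[OF T h]])
  have iter: "(T' ^^ n) (h x) = h ((T ^^ n) x)" for n x
    by (induction n) (auto simp: T'_def)
  have f: "f0 \<circ> inv h \<in> borel_measurable M'" "f1 \<circ> inv h \<in> borel_measurable M'"
    by (rule measurable_comp[OF invh f0], rule measurable_comp[OF invh f1])
  have space: "space M' = h ` space M" by (simp add: M'_def space_embed_measure)
  have "measure_preserving_system M' T'"
    unfolding measure_preserving_system_def
  proof (intro conjI ballI T')
    show "prob_space M'" by (subst distr) (rule prob_space.prob_space_distr[OF prob h])
    fix A assume A: "A \<in> sets M'"
    have "emeasure M' (T' -` A \<inter> space M') = emeasure M (h -` (T' -` A \<inter> space M') \<inter> space M)"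
      by (subst (1) distr, subst emeasure_distr) (use measurable_sets[OF T' A] in simp_all)
    also have "h -` (T' -` A \<inter> space M') \<inter> space M = T -` (h -` A \<inter> space M) \<inter> space M"
      using measurable_space[OF T] by (auto simp: T'_def space inj_eq[OF \<open>inj h\<close>])
    also have "emeasure M \<dots> = emeasure M (h -` A \<inter> space M)"
      by (rule mp) (rule measurable_sets[OF h A])
    also have "\<dots> = emeasure M' A"
      by (rule emeasure_distr[OF h A, folded distr, symmetric])
    finally show "emeasure M' (T' -` A \<inter> space M') = emeasure M' A" .
  qed
  moreover have "(\<integral>x. (f0 \<circ> inv h) x * (f1 \<circ> inv h) ((T' ^^ n) x) \<partial>M') =
      (\<integral>x. f0 x * f1 ((T ^^ n) x) \<partial>M)" for n
  proof -
    have [measurable]: "(T' ^^ n) \<in> measurable M' M'"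
      by (rule measurable_compose_n[OF T'])
    note invh[measurable]
    show ?thesis
      by (subst distr, subst integral_distr) (auto simp: iter)
  qed
  moreover have "bounded ((f0 \<circ> inv h) ` space M')" "bounded ((f1 \<circ> inv h) ` space M')"
    using b0 b1 by (simp_all add: space image_image)
  ultimately show ?thesis unfolding one_correlation_def using f a
    by (intro exI[of _ M'] exI[of _ T'] exI[of _ "f0 \<circ> inv h"] exI[of _ "f1 \<circ> inv h"]) simp
qed

lemma inj_real_pair:
  includes cardinal_syntax
  shows "\<exists>h :: real \<times> real \<Rightarrow> real. inj h"
proof -
  have "|UNIV \<times> UNIV :: (real \<times> real) set| =o |UNIV :: real set|"
    by (rule card_of_Times_same_infinite) (simp add: infinite_UNIV_char_0)
  then have "|UNIV :: (real \<times> real) set| \<le>o |UNIV :: real set|"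
    by (simp add: ordIso_imp_ordLeq)
  then show ?thesis using card_of_ordLeq[of "UNIV :: (real \<times> real) set" "UNIV :: real set"] by auto
qed

section \<open>A Cantor measure and its Fourier transform\<close>

definition coin_sequences :: "(nat \<Rightarrow> bool) measure" where
  "coin_sequences = PiM UNIV (\<lambda>_. measure_pmf (bernoulli_pmf (1/2)))"

text \<open>Under fair coin tosses this point has base-\<open>4\<close> digits \<open>0\<close> and \<open>1\<close>, chosen independently.\<close>

definition cantor_point :: "(nat \<Rightarrow> bool) \<Rightarrow> real" where
  "cantor_point \<omega> = (\<Sum>k. of_bool (\<omega> k) / 4 ^ Suc k)"

lemma prob_space_coin_sequences: "prob_space coin_sequences"
  unfolding coin_sequences_def by (rule prob_space_PiM) (rule prob_space_measure_pmf)

lemma measurable_cantor_point [measurable]: "cantor_point \<in> borel_measurable coin_sequences"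
proof -
  have [measurable]: "(\<lambda>\<omega>. \<omega> k) \<in> measurable coin_sequences (count_space UNIV)" for k
    unfolding coin_sequences_def
    by (rule measurable_compose[OF measurable_component_singleton]) auto
  show ?thesis unfolding cantor_point_def by measurable
qed

lemma geometric_quarter: "(\<lambda>k. 1 / 4 ^ Suc k) sums (1 / 3 :: real)"
proof -
  have "(\<lambda>k. (1/4) * (1/4) ^ k) sums ((1/4) * (1 / (1 - 1/4)) :: real)"
    by (intro sums_mult geometric_sums) auto
  then show ?thesis by (simp add: power_divide)
qed

lemma summable_cantor_point: "summable (\<lambda>k. of_bool (\<omega> k) / 4 ^ Suc k :: real)"
  by (rule summable_comparison_test'[OF sums_summable[OF geometric_quarter], of 0]) auto

lemma cantor_point_bounds: "0 \<le> cantor_point \<omega>" "cantor_point \<omega> \<le> 1 / 3"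
proof -
  show "0 \<le> cantor_point \<omega>"
    unfolding cantor_point_def by (rule suminf_nonneg[OF summable_cantor_point]) simp
  have "cantor_point \<omega> \<le> (\<Sum>k. 1 / 4 ^ Suc k)"
    unfolding cantor_point_def
    by (rule suminf_le[OF _ summable_cantor_point sums_summable[OF geometric_quarter]])
       (simp add: divide_right_mono)
  then show "cantor_point \<omega> \<le> 1 / 3" using sums_unique[OF geometric_quarter] by simp
qed

lemma cantor_point_case_nat: "cantor_point (case_nat b \<omega>) = (of_bool b + cantor_point \<omega>) / 4"
proof -
  have "cantor_point (case_nat b \<omega>) =
      of_bool b / 4 + (\<Sum>k. of_bool (\<omega> k) / 4 ^ Suc (Suc k))"
    unfolding cantor_point_def using suminf_split_head[OF summable_cantor_point[of "case_nat b \<omega>"]]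
    by simp
  also have "(\<Sum>k. of_bool (\<omega> k) / 4 ^ Suc (Suc k)) = (\<Sum>k. of_bool (\<omega> k) / 4 ^ Suc k / (4::real))"
    by (simp add: field_simps)
  also have "\<dots> = cantor_point \<omega> / 4"
    unfolding cantor_point_def by (rule suminf_divide[OF summable_cantor_point])
  finally show ?thesis by (simp add: add_divide_distrib)
qed

definition cantor_fourier :: "real \<Rightarrow> complex" where
  "cantor_fourier x = (\<integral>\<omega>. phase (x * cantor_point \<omega>) \<partial>coin_sequences)"

lemma integrable_phase_coin [simp]: "integrable coin_sequences (\<lambda>\<omega>. phase (x * cantor_point \<omega>))"
proof -
  interpret prob_space coin_sequences by (rule prob_space_coin_sequences)
  show ?thesis by (rule integrable_const_bound[where B = 1]) auto
qed

text \<open>The law of the random point \<open>t\<close> is self-similar: \<open>4 t\<close> is distributed as \<open>b + t'\<close> with a fair bit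
  \<open>b\<close> that is independent of the copy \<open>t'\<close> of \<open>t\<close>. Iterating the identity gives the infinite product
  \<open>\<Prod>k\<ge>1. (1 + phase (x / 4 ^ k)) / 2\<close>; the functional equation alone suffices to evaluate it
  at the relevant integers.\<close>
lemma cantor_fourier_scaling: "cantor_fourier (4 * x) = (1 + phase x) / 2 * cantor_fourier x"
proof -
  let ?B = "measure_pmf (bernoulli_pmf (1/2))"
  interpret B: prob_space ?B by (rule prob_space_measure_pmf)
  interpret S: sequence_space ?B ..
  interpret C: prob_space coin_sequences by (rule prob_space_coin_sequences)
  interpret P: pair_prob_space ?B coin_sequences ..
  have iter: "distr (?B \<Otimes>\<^sub>M coin_sequences) coin_sequences (\<lambda>(b, \<omega>). case_nat b \<omega>) = coin_sequences"
    using S.PiM_iter by (simp add: coin_sequences_def)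
  have [measurable]: "(\<lambda>(b, \<omega>). case_nat b \<omega>) \<in> measurable (?B \<Otimes>\<^sub>M coin_sequences) coin_sequences"
    unfolding coin_sequences_def by measurable
  define G where "G = (\<lambda>(b, \<omega>). phase (of_bool b * x) * phase (x * cantor_point \<omega>))"
  have [measurable]: "G \<in> borel_measurable (?B \<Otimes>\<^sub>M coin_sequences)"
    unfolding G_def by measurable
  have G: "integrable (?B \<Otimes>\<^sub>M coin_sequences) G"
    by (rule P.P.integrable_const_bound[where B = 1]) (auto simp: G_def norm_mult)
  have "cantor_fourier (4 * x) =
      (\<integral>\<omega>. phase (4 * x * cantor_point \<omega>)
        \<partial>distr (?B \<Otimes>\<^sub>M coin_sequences) coin_sequences (\<lambda>(b, \<omega>). case_nat b \<omega>))"
    by (simp only: cantor_fourier_def iter)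
  also have "\<dots> = (\<integral>z. G z \<partial>(?B \<Otimes>\<^sub>M coin_sequences))"
  proof -
    have "4 * x * ((of_bool b + c) / 4) = of_bool b * x + x * c" for b c
      by (simp add: field_simps)
    then have "phase (4 * x * cantor_point (case_nat b \<omega>)) = G (b, \<omega>)" for b \<omega>
      by (simp add: cantor_point_case_nat G_def phase_add)
    then show ?thesis
      by (subst integral_distr) (auto intro!: Bochner_Integration.integral_cong)
  qed
  also have "\<dots> = (\<integral>b. \<integral>\<omega>. G (b, \<omega>) \<partial>coin_sequences \<partial>?B)"
    by (rule P.integral_fst'[OF G, symmetric])
  also have "\<dots> = (\<integral>b. phase (of_bool b * x) * cantor_fourier x \<partial>?B)"
    by (simp add: G_def cantor_fourier_def)
  also have "\<dots> = (1 + phase x) / 2 * cantor_fourier x"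
    by (subst integral_measure_pmf[where A = UNIV]) (auto simp: UNIV_bool scaleR_conv_of_real field_simps)
  finally show ?thesis .
qed

lemma cantor_fourier_pow4: "cantor_fourier (4 ^ k * of_nat n) = cantor_fourier (of_nat n)"
proof (induction k)
  case (Suc k)
  have "phase (4 ^ k * of_nat n) = 1"
    using phase_of_nat[of "4 ^ k * n"] by simp
  with Suc show ?case
    using cantor_fourier_scaling[of "4 ^ k * of_nat n"] by (simp add: mult.assoc)
qed simp

lemma cantor_fourier_2_mod_4: "cantor_fourier (of_nat (4 * n + 2)) = 0"
proof -
  have "phase (of_nat n + 1 / 2) = -1"
    unfolding phase_add phase_of_nat by (simp add: phase_def)
  then show ?thesis using cantor_fourier_scaling[of "of_nat n + 1 / 2"]
    by (simp add: algebra_simps)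
qed

text \<open>One application of the scaling identity reduces the claim to frequency \<open>1/4\<close>, where all phases
  \<open>phase (t / 4)\<close> lie within an angle \<open>\<pi>/6\<close> of \<open>1\<close> and cannot cancel.\<close>
lemma cantor_fourier_1_nonzero: "cantor_fourier 1 \<noteq> 0"
proof -
  interpret C: prob_space coin_sequences by (rule prob_space_coin_sequences)
  have "1 / 2 \<le> Re (phase (1 / 4 * cantor_point \<omega>))" for \<omega>
  proof -
    have "cos (pi / 3) \<le> cos (pi * cantor_point \<omega> / 2)"
      using cantor_point_bounds[of \<omega>] by (intro cos_monotone_0_pi_le) (auto simp: field_simps)
    then show ?thesis by (simp add: phase_def cos_60 mult.commute)
  qed
  then have "1 / 2 \<le> (\<integral>\<omega>. Re (phase (1 / 4 * cantor_point \<omega>)) \<partial>coin_sequences)"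
    by (intro C.integral_ge_const integrable_Re integrable_phase_coin) auto
  then have "Re (cantor_fourier (1 / 4)) \<noteq> 0"
    unfolding cantor_fourier_def integral_Re[OF integrable_phase_coin] by linarith
  then have "cantor_fourier (1 / 4) \<noteq> 0" by auto
  moreover have "1 + phase (1 / 4) \<noteq> 0"
    by (simp add: phase_def complex_eq_iff)
  ultimately show ?thesis using cantor_fourier_scaling[of "1 / 4"] by (metis divide_eq_0_iff mult_eq_0_iff nonzero_mult_div_cancel_left times_divide_eq_right zero_neq_numeral mult_1_right)
qed

lemma one_correlation_cantor_fourier: "one_correlation TYPE(real) (\<lambda>n. cantor_fourier (of_nat n))"
proof -
  obtain h :: "real \<times> real \<Rightarrow> real" where "inj h" using inj_real_pair by blast
  have "prob_space (distr coin_sequences borel cantor_point)"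
    by (rule prob_space.prob_space_distr[OF prob_space_coin_sequences]) measurable
  from one_correlation_transfer[OF \<open>inj h\<close> one_correlation_fourier_coefficients[OF this]]
  show ?thesis by (simp add: cantor_fourier_def integral_distr)
qed

section \<open>Almost periodicity forces many returns\<close>

text \<open>Pigeonhole: cover the unit disc by finitely many discs of radius \<open>\<eta>/2\<close>, and colour each index \<open>i\<close> by the
  discs that contain \<open>z i 1, ..., z i m\<close>. The number of colours does not depend on the window.\<close>
lemma close_pair_in_window:
  fixes z :: "nat \<Rightarrow> nat \<Rightarrow> complex"
  assumes "\<And>i l. cmod (z i l) \<le> 1" and "\<eta> > 0"
  shows "\<exists>W>0. \<forall>s. \<exists>i j. s \<le> i \<and> i < j \<and> j < s + W \<and> (\<forall>l\<in>{1..m}. cmod (z j l - z i l) < \<eta>)"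
proof -
  obtain K where K: "finite K" "cball (0::complex) 1 \<subseteq> (\<Union>x\<in>K. ball x (\<eta> / 2))"
    using compact_cball[of "0::complex" 1] half_gt_zero[OF \<open>\<eta> > 0\<close>]
    unfolding compact_eq_totally_bounded by blast
  have "\<exists>x\<in>K. dist x (z i l) < \<eta> / 2" for i l
  proof -
    have "z i l \<in> cball 0 1" using assms(1)[of i l] by simp
    with K(2) show ?thesis by (fastforce simp: mem_ball)
  qed
  then obtain c where c: "c i l \<in> K" "dist (c i l) (z i l) < \<eta> / 2" for i l
    by metis
  define colour where "colour i = restrict (c i) {1..m}" for i
  define W where "W = card ({1..m} \<rightarrow>\<^sub>E K) + 1"
  have "\<exists>i j. s \<le> i \<and> i < j \<and> j < s + W \<and> (\<forall>l\<in>{1..m}. cmod (z j l - z i l) < \<eta>)" for s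
  proof -
    have fin: "finite ({1..m} \<rightarrow>\<^sub>E K)" using K(1) by (simp add: finite_PiE)
    have "colour ` {s..<s + W} \<subseteq> {1..m} \<rightarrow>\<^sub>E K"
      using c(1) by (auto simp: colour_def)
    then have "card (colour ` {s..<s + W}) < card {s..<s + W}"
      using card_mono[OF fin, of "colour ` {s..<s + W}"] by (simp add: W_def)
    then have "\<not> inj_on colour {s..<s + W}" by (rule pigeonhole)
    then obtain i j where ij: "i \<in> {s..<s + W}" "j \<in> {s..<s + W}" "i < j" "colour i = colour j"
      by (metis linorder_inj_onI')
    have "cmod (z j l - z i l) < \<eta>" if "l \<in> {1..m}" for l
    proof -
      have "c i l = c j l" using ij(4) that by (simp add: colour_def restrict_def) metis
      then show ?thesis using c(2)[of i l] c(2)[of j l]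
        using dist_triangle_half_r[of "c i l" "z j l" \<eta> "z i l"] by (simp add: dist_norm)
    qed
    with ij show ?thesis by (intro exI[of _ i] exI[of _ j]) auto
  qed
  then show ?thesis by (intro exI[of _ W]) (simp add: W_def)
qed

text \<open>Shifting a frequency \<open>\<alpha>\<close> from time \<open>n + d i\<close> to \<open>n + d j\<close> costs
  \<open>\<bar>phase (d j * \<alpha>) - phase (d i * \<alpha>)\<bar>\<close>, whatever \<open>n\<close> is. So it is enough to have the finitely many phases
  at \<open>d i\<close> and \<open>d j\<close> close to each other, which happens in every window of fixed length.\<close>
lemma trig_polynomial_increment:
  fixes d :: "nat \<Rightarrow> nat"
  assumes "trig_polynomial p" and "\<epsilon> > 0"
  shows "\<exists>W>0. \<forall>s. \<exists>i j. s \<le> i \<and> i < j \<and> j < s + W \<and>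
      (\<forall>n. cmod (p (n + d j) - p (n + d i)) \<le> \<epsilon>)"
proof -
  obtain m :: nat and c \<alpha> where p: "\<And>n. p n = (\<Sum>l=1..m. c l * phase (of_nat n * \<alpha> l))"
  proof -
    have "exp (2 * of_real pi * \<i> * of_nat n * of_real x) = phase (of_nat n * x)" for n x
      by (simp add: phase_def cis_conv_exp mult_ac)
    then have "\<exists>(m::nat) c \<alpha>. \<forall>n. p n = (\<Sum>l=1..m. c l * phase (of_nat n * \<alpha> l))"
      using assms(1) by (simp only: trig_polynomial_def)
    with that show thesis by blast
  qed
  \<comment> \<open>The summand \<open>1\<close> keeps \<open>C\<close> positive when all coefficients vanish.\<close>
  define C where "C = (\<Sum>l=1..m. cmod (c l)) + 1"
  have "C > 0" unfolding C_def by (intro add_nonneg_pos sum_nonneg) auto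
  have close: "cmod (p (n + d j) - p (n + d i)) \<le> \<epsilon>"
    if "\<forall>l\<in>{1..m}. cmod (phase (of_nat (d j) * \<alpha> l) - phase (of_nat (d i) * \<alpha> l)) < \<epsilon> / C" for n i j
  proof -
    have "p (n + d j) - p (n + d i) =
        (\<Sum>l=1..m. c l * phase (of_nat n * \<alpha> l) * (phase (of_nat (d j) * \<alpha> l) - phase (of_nat (d i) * \<alpha> l)))"
      unfolding p sum_subtractf[symmetric] by (simp add: ring_distribs phase_add mult.assoc)
    also have "cmod \<dots> \<le> (\<Sum>l=1..m. cmod (c l) * (\<epsilon> / C))"
    proof (rule sum_norm_le)
      fix l assume "l \<in> {1..m}"
      then have "cmod (phase (of_nat (d j) * \<alpha> l) - phase (of_nat (d i) * \<alpha> l)) \<le> \<epsilon> / C"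
        using that by (blast intro: less_imp_le)
      then show "cmod (c l * phase (of_nat n * \<alpha> l) * (phase (of_nat (d j) * \<alpha> l) - phase (of_nat (d i) * \<alpha> l)))
          \<le> cmod (c l) * (\<epsilon> / C)"
        unfolding norm_mult norm_phase mult_1_right by (rule mult_left_mono) simp
    qed
    also have "\<dots> = (C - 1) * (\<epsilon> / C)" unfolding sum_distrib_right[symmetric] by (simp add: C_def)
    also have "\<dots> \<le> C * (\<epsilon> / C)" using \<open>C > 0\<close> \<open>\<epsilon> > 0\<close> by (intro mult_right_mono) auto
    finally show ?thesis using \<open>C > 0\<close> by simp
  qed
  obtain W where "W > 0" and W: "\<And>s. \<exists>i j. s \<le> i \<and> i < j \<and> j < s + W \<and>
      (\<forall>l\<in>{1..m}. cmod (phase (of_nat (d j) * \<alpha> l) - phase (of_nat (d i) * \<alpha> l)) < \<epsilon> / C)"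
  proof -
    have "\<epsilon> / C > 0" using \<open>C > 0\<close> \<open>\<epsilon> > 0\<close> by simp
    from close_pair_in_window[of "\<lambda>i l. phase (of_nat (d i) * \<alpha> l)", OF _ this, of m] that show thesis
      by (auto simp only: norm_phase order_refl)
  qed
  have "\<exists>i j. s \<le> i \<and> i < j \<and> j < s + W \<and> (\<forall>n. cmod (p (n + d j) - p (n + d i)) \<le> \<epsilon>)" for s
  proof -
    obtain i j where "s \<le> i" "i < j" "j < s + W"
      and "\<forall>l\<in>{1..m}. cmod (phase (of_nat (d j) * \<alpha> l) - phase (of_nat (d i) * \<alpha> l)) < \<epsilon> / C"
      using W[of s] by blast
    then show ?thesis using close by (intro exI[of _ i] exI[of _ j]) simp
  qed
  with \<open>W > 0\<close> show ?thesis by blast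
qed

section \<open>Listing the pairs so that windows are visited with positive density\<close>

text \<open>Writing \<open>m + 1 = 2 ^ g * (2 * q + 1)\<close> lists every pair \<open>i < j\<close> exactly once, as \<open>i = q\<close> and
  \<open>j = q + g + 1\<close>. In this list the pairs of a given gap have positive density, so that
  finding one good pair of bounded gap in every window already yields a positive proportion of good
  pairs; along the diagonal listing this would guarantee only of the order of \<open>sqrt N\<close> good pairs among
  the first \<open>N\<close>.\<close>

definition pair_gap :: "nat \<Rightarrow> nat" where
  "pair_gap m = multiplicity 2 (Suc m)"

definition pair_fst :: "nat \<Rightarrow> nat" where
  "pair_fst m = Suc m div 2 ^ Suc (pair_gap m)"

definition pair_snd :: "nat \<Rightarrow> nat" where
  "pair_snd m = pair_fst m + pair_gap m + 1"

lemma Suc_eq_pair: "Suc m = 2 ^ pair_gap m * (2 * pair_fst m + 1)"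
proof -
  obtain u where u: "Suc m = 2 ^ pair_gap m * u" "odd u"
    unfolding pair_gap_def using multiplicity_decompose'[of "Suc m" "2::nat"] by auto
  then have "pair_fst m = u div 2"
    by (simp add: pair_fst_def)
  with u show ?thesis by simp
qed

lemma pair_of_code:
  assumes "Suc m = 2 ^ g * (2 * q + 1)"
  shows "pair_fst m = q" "pair_snd m = q + g + 1"
proof -
  have "pair_gap m = g"
    unfolding pair_gap_def assms
    by (rule multiplicity_eqI) (simp_all add: power_Suc2 del: power_Suc mult_Suc_right)
  moreover from this show "pair_fst m = q"
    by (simp add: pair_fst_def assms power_Suc2 del: power_Suc mult_Suc_right)
  ultimately show "pair_snd m = q + g + 1" by (simp add: pair_snd_def)
qed

lemma pair_fst_less_snd: "pair_fst m < pair_snd m"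
  by (simp add: pair_snd_def)

text \<open>The entries of the \<open>m\<close>-th pair are at most \<open>m + 1\<close>, so the perturbation \<open>d j - d i\<close> of the
  \<open>m\<close>-th time \<open>4 ^ (m + 2)\<close> below is smaller than that time.\<close>
lemma pair_snd_le: "pair_snd m \<le> m + 1"
proof -
  have "pair_gap m + 1 \<le> 2 ^ pair_gap m" by (simp add: Suc_leI)
  then have "(pair_gap m + 1) * (2 * pair_fst m + 1) \<le> Suc m"
    unfolding Suc_eq_pair[of m] by (rule mult_right_mono) simp
  then show ?thesis by (simp add: pair_snd_def algebra_simps)
qed

text \<open>Each window \<open>[s * W, (s + 1) * W)\<close> contains a good pair; its gap is below \<open>W\<close>, so it is
  listed before position \<open>K * (s + 1)\<close>. Different windows give different positions, since the first entries differ. The window \<open>s = 0\<close> is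
  discarded, as it might give position \<open>0\<close>.\<close>
lemma good_pairs_positive_density:
  assumes "W > 0" and good: "\<And>s. \<exists>i j. s \<le> i \<and> i < j \<and> j < s + W \<and> good i j"
  shows "\<exists>K>0. \<forall>S. \<exists>G \<subseteq> {1..<K * Suc S}. card G = S \<and> (\<forall>m\<in>G. good (pair_fst m) (pair_snd m))"
proof -
  define K where "K = 2 ^ W * (4 * W)"
  have "\<exists>m. s * W \<le> pair_fst m \<and> pair_fst m < Suc s * W \<and> m < K * Suc s \<and>
      good (pair_fst m) (pair_snd m)" for s
  proof -
    obtain i j where ij: "s * W \<le> i" "i < j" "j < s * W + W" "good i j"
      using good by blast
    define g where "g = j - i - 1"
    define m where "m = 2 ^ g * (2 * i + 1) - 1"
    have m: "Suc m = 2 ^ g * (2 * i + 1)" by (simp add: m_def)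
    have "g < W" using ij by (auto simp: g_def)
    have "Suc m \<le> 2 ^ W * (2 * (Suc s * W) + 1)"
      unfolding m using ij \<open>g < W\<close> by (intro mult_mono power_increasing) auto
    also have "\<dots> \<le> 2 ^ W * (4 * W * Suc s)"
      using \<open>W > 0\<close> by (intro mult_left_mono) auto
    finally have "Suc m \<le> K * Suc s" unfolding K_def by (simp only: mult.assoc)
    with ij pair_of_code[OF m] show ?thesis by (intro exI[of _ m]) (auto simp: g_def)
  qed
  then obtain code where code: "s * W \<le> pair_fst (code s)" "pair_fst (code s) < Suc s * W"
      "code s < K * Suc s" "good (pair_fst (code s)) (pair_snd (code s))" for s
    by metis
  have mono: "pair_fst (code s) < pair_fst (code s')" if "s < s'" for s s'
  proof -
    have "Suc s * W \<le> s' * W" using that by (intro mult_right_mono) auto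
    with code(2)[of s] code(1)[of s'] show ?thesis by linarith
  qed
  then have inj: "inj_on code A" for A
    by (metis linorder_inj_onI' order_less_irrefl)
  have "\<exists>G \<subseteq> {1..<K * Suc S}. card G = S \<and> (\<forall>m\<in>G. good (pair_fst m) (pair_snd m))" for S
  proof (intro exI[of _ "code ` {1..S}"] conjI)
    show "code ` {1..S} \<subseteq> {1..<K * Suc S}"
    proof safe
      fix s assume s: "s \<in> {1..S}"
      have "pair_fst (code s) > 0" using code(1)[of s] s \<open>W > 0\<close> by (metis atLeastAtMost_iff less_le_trans nat_0_less_mult_iff zero_less_one)
      then have "code s \<noteq> 0" using pair_fst_less_snd[of "code s"] pair_snd_le[of "code s"] by linarith
      moreover have "K * Suc s \<le> K * Suc S" using s by simp
      ultimately show "code s \<in> {1..<K * Suc S}"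
        using less_le_trans[OF code(3)[of s]] by (simp del: mult_Suc_right mult_le_cancel1)
    qed
    show "card (code ` {1..S}) = S" by (simp add: card_image[OF inj])
  qed (use code(4) in auto)
  moreover have "K > 0" using \<open>W > 0\<close> by (simp add: K_def)
  ultimately show ?thesis by blast
qed

text \<open>The terms of index up to \<open>2 * K * (S + 1)\<close> have sum at least \<open>S * \<delta>\<close>. Consecutive lengths of this
  form differ by the constant \<open>2 * K\<close>, so the averages are bounded below by nearly \<open>\<delta> / (2 * K)\<close> for all
  large \<open>N\<close>; half of this is left after rounding \<open>N\<close>.\<close>
lemma liminf_average_pos:
  fixes x :: "nat \<Rightarrow> real"
  assumes nonneg: "\<And>n. 0 \<le> x n" and "\<delta> > 0" and "K > 0"
    and G: "\<forall>S. \<exists>G \<subseteq> {1..<K * Suc S}. card G = S \<and> (\<forall>m\<in>G. \<delta> \<le> x (2 * m) + x (2 * m + 1))"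
  shows "0 < liminf (\<lambda>N. ereal (1 / real N * (\<Sum>n=1..N. x n)))"
proof -
  have "\<delta> / (4 * K) \<le> 1 / real N * (\<Sum>n=1..N. x n)" if N: "8 * K \<le> N" for N
  proof -
    define S where "S = N div (2 * K) - 1"
    have "4 \<le> N div (2 * K)" using N \<open>K > 0\<close> by (simp add: less_eq_div_iff_mult_less_eq)
    then have S: "Suc S = N div (2 * K)" by (simp add: S_def)
    obtain G where G: "G \<subseteq> {1..<K * Suc S}" "card G = S" "\<forall>m\<in>G. \<delta> \<le> x (2 * m) + x (2 * m + 1)"
      using assms(4) by meson
    have "finite G" using G(1) finite_subset by blast
    have "2 * K * Suc S \<le> N" unfolding S by (rule times_div_less_eq_dividend)
    then have sub: "(\<lambda>m. 2 * m) ` G \<union> (\<lambda>m. 2 * m + 1) ` G \<subseteq> {1..N}"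
      using G(1) by fastforce
    have "N < 2 * K * (Suc S + 1)" using S \<open>K > 0\<close>
      by (metis add.commute dividend_less_times_div mult_pos_pos plus_1_eq_Suc mult_Suc_right zero_less_numeral)
    then have "real N < 2 * K * (real S + 2)"
      using of_nat_less_iff[of N "2 * K * (Suc S + 1)", where 'a = real] by (simp add: algebra_simps)
    moreover have "3 \<le> real S" using S \<open>4 \<le> N div (2 * K)\<close> by linarith
    ultimately have "real N \<le> 2 * K * (2 * real S)"
      using \<open>K > 0\<close> by (smt (verit) mult_left_mono of_nat_0_le_iff)
    then have "\<delta> * real N \<le> \<delta> * real S * (4 * K)"
      using \<open>\<delta> > 0\<close> by (simp add: mult.assoc mult_le_cancel_left_pos mult.left_commute mult.commute)
    then have scale: "\<delta> * real N \<le> (real S * \<delta>) * (4 * K)"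
      by (simp only: mult.commute[of \<delta>])
    have "real S * \<delta> \<le> (\<Sum>m\<in>G. x (2 * m) + x (2 * m + 1))"
      using sum_bounded_below[of G \<delta> "\<lambda>m. x (2 * m) + x (2 * m + 1)"] G by simp
    also have "(\<Sum>m\<in>G. x (2 * m) + x (2 * m + 1)) = sum x ((\<lambda>m. 2 * m) ` G) + sum x ((\<lambda>m. 2 * m + 1) ` G)"
      by (simp add: sum.distrib sum.reindex inj_on_def)
    also have "\<dots> = sum x ((\<lambda>m. 2 * m) ` G \<union> (\<lambda>m. 2 * m + 1) ` G)"
      by (rule sum.union_disjoint[symmetric]) (use \<open>finite G\<close> in \<open>auto, presburger\<close>)
    also have "\<dots> \<le> (\<Sum>n=1..N. x n)"
      by (rule sum_mono2[OF _ sub]) (use nonneg in auto)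
    finally have "\<delta> * real N \<le> (\<Sum>n=1..N. x n) * (4 * K)"
      using scale \<open>K > 0\<close> by (smt (verit) mult_right_mono of_nat_0_le_iff)
    moreover have "0 < N" using N \<open>K > 0\<close> by linarith
    ultimately show ?thesis using \<open>K > 0\<close> by (simp add: field_simps)
  qed
  then have "ereal (\<delta> / (4 * K)) \<le> liminf (\<lambda>N. ereal (1 / real N * (\<Sum>n=1..N. x n)))"
    by (intro Liminf_bounded eventually_sequentiallyI[of "8 * K"]) simp
  moreover have "0 < ereal (\<delta> / (4 * K))" using \<open>\<delta> > 0\<close> \<open>K > 0\<close> by simp
  ultimately show ?thesis by (rule less_le_trans[rotated])
qed

section \<open>The sequence of times and the theorem\<close>

text \<open>The \<open>m\<close>-th pair \<open>i < j\<close> contributes two times, \<open>4 ^ (m + 2)\<close> and \<open>4 ^ (m + 2) + d j - d i\<close>, where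
  \<open>d i = 2 * 4 ^ i\<close>.\<close>

definition far_time :: "nat \<Rightarrow> nat" where
  "far_time n = (let m = n div 2 in
     4 ^ (m + 2) + (if odd n then 2 * 4 ^ pair_snd m - 2 * 4 ^ pair_fst m else 0))"

lemma far_time_even: "far_time (2 * m) = 4 ^ (m + 2)"
  by (simp add: far_time_def)

lemma far_time_odd:
  "far_time (2 * m + 1) + 2 * 4 ^ pair_fst m = 4 ^ (m + 2) + 2 * 4 ^ pair_snd m"
proof -
  have "(4::nat) ^ pair_fst m \<le> 4 ^ pair_snd m"
    using pair_fst_less_snd[of m] by (intro power_increasing) auto
  then show ?thesis by (simp add: far_time_def trans_le_add2)
qed

lemma strict_mono_far_time: "strict_mono far_time"
proof (rule strict_monoI_Suc)
  fix n :: nat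
  define m where "m = n div 2"
  have lt: "(4::nat) ^ pair_fst m < 4 ^ pair_snd m"
    using pair_fst_less_snd by (intro power_strict_increasing) auto
  have le: "(4::nat) ^ pair_snd m \<le> 4 ^ (m + 1)"
    using pair_snd_le by (intro power_increasing) auto
  show "far_time n < far_time (Suc n)"
  proof (cases "even n")
    case True
    then have n: "n = 2 * m" by (simp add: m_def)
    have "far_time (2 * m) < far_time (2 * m + 1)"
      using far_time_even[of m] far_time_odd[of m] lt by linarith
    then show ?thesis by (simp add: n)
  next
    case False
    then have n: "n = 2 * m + 1" "Suc n = 2 * (m + 1)" by (simp_all add: m_def)
    show ?thesis unfolding n(2) far_time_even unfolding n(1)
    proof -
      have "(4::nat) ^ (m + 1) = 4 * 4 ^ m" "(4::nat) ^ (m + 2) = 16 * 4 ^ m"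
        "(4::nat) ^ (m + 1 + 2) = 64 * 4 ^ m" "(0::nat) < 4 ^ m"
        by simp_all
      with far_time_odd[of m] le show "far_time (2 * m + 1) < 4 ^ (m + 1 + 2)"
        by linarith
    qed
  qed
qed

lemma cantor_fourier_even: "cantor_fourier (of_nat (far_time (2 * m))) = cantor_fourier 1"
  using cantor_fourier_pow4[of "m + 2" 1] by (simp add: far_time_even)

text \<open>Because \<open>i < j\<close> and \<open>i < m + 2\<close>, the time \<open>4 ^ (m + 2) + 2 * 4 ^ j - 2 * 4 ^ i\<close> is \<open>4 ^ i\<close> times a number
  congruent to \<open>2\<close> modulo \<open>4\<close>, and there one factor of the transform is \<open>1 + phase (1/2) = 0\<close>.\<close>
lemma cantor_fourier_odd: "cantor_fourier (of_nat (far_time (2 * m + 1))) = 0"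
proof -
  define i where "i = pair_fst m"
  obtain u where u: "pair_snd m = i + Suc u"
    unfolding i_def using less_imp_Suc_add[OF pair_fst_less_snd] by auto
  define v where "v = m + 1 - i"
  have v: "m + 2 = i + Suc v" using pair_snd_le[of m] u by (simp add: v_def)
  define b :: nat where "b = 4 ^ v - 1"
  have b: "4 ^ v = b + 1" by (simp add: b_def)
  define w :: nat where "w = b + 2 * 4 ^ u"
  have "4 * w + 4 = 4 * (4 ^ v + 2 * 4 ^ u)"
    by (simp add: w_def b)
  then have "4 ^ i * (4 * w + 4) = 4 ^ (m + 2) + 2 * 4 ^ pair_snd m"
    unfolding u v by (simp only:) (simp add: power_add algebra_simps)
  then have "far_time (2 * m + 1) = 4 ^ i * (4 * w + 2)"
    using far_time_odd[of m] by (simp add: i_def algebra_simps)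
  then have "real (far_time (2 * m + 1)) = 4 ^ i * real (4 * w + 2)" by (simp add: algebra_simps)
  then show ?thesis
    by (simp only: cantor_fourier_pow4 cantor_fourier_2_mod_4)
qed

text \<open>The form in which two values of the correlation are compared through a sequence \<open>\<psi>\<close> and a
  trigonometric polynomial near it.\<close>
lemma norm_triangle_six:
  fixes a b c d f :: complex
  shows "cmod (a - b + (- c - d + f)) \<le> cmod a + cmod b + (cmod c + cmod d + cmod f)"
  using norm_triangle_ineq[of "a - b" "- c - d + f"] norm_triangle_ineq4[of a b]
    norm_triangle_ineq[of "- c - d" f] norm_triangle_ineq4[of "- c" d] by simp

theorem proposition1p10:
  "\<exists>(r :: nat \<Rightarrow> nat) (a :: nat \<Rightarrow> complex).
     (\<forall>n\<ge>1. r n \<ge> 1) \<and> strict_mono_on {1..} r \<and>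
     one_correlation TYPE(real) a \<and>
     (\<forall>\<psi>. almost_periodic \<psi> \<longrightarrow>
        liminf (\<lambda>N. ereal (1 / real N * (\<Sum>n=1..N. cmod (a (r n) - \<psi> (r n))))) > 0)"
proof (intro exI conjI allI impI)
  let ?a = "\<lambda>n. cantor_fourier (of_nat n)"
  show pos: "1 \<le> far_time n" for n by (simp add: far_time_def Let_def trans_le_add1)
  show "strict_mono_on {1..} far_time"
    using strict_mono_far_time by (simp add: strict_mono_on_def strict_mono_def)
  show "one_correlation TYPE(real) ?a" by (rule one_correlation_cantor_fourier)
  fix \<psi> assume "almost_periodic \<psi>"
  define \<kappa> where "\<kappa> = cmod (cantor_fourier 1)"
  have "\<kappa> > 0" using cantor_fourier_1_nonzero by (simp add: \<kappa>_def)
  obtain P where P: "\<forall>k. trig_polynomial (P k)" "uniform_limit {1..} P \<psi> sequentially"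
    using \<open>almost_periodic \<psi>\<close> unfolding almost_periodic_def by blast
  have "\<forall>\<^sub>F k in sequentially. \<forall>n\<in>{1..}. dist (P k n) (\<psi> n) < \<kappa> / 6"
    by (rule uniform_limitD[OF P(2)]) (use \<open>\<kappa> > 0\<close> in simp)
  from eventually_happens'[OF sequentially_bot this]
  obtain k where k: "\<forall>n\<in>{1..}. dist (P k n) (\<psi> n) < \<kappa> / 6" by blast
  define p where "p = P k"
  have approx: "cmod (p n - \<psi> n) < \<kappa> / 6" if "1 \<le> n" for n
    using k that by (simp add: p_def dist_norm)
  have p: "trig_polynomial p" using P(1) by (simp add: p_def)
  define good where "good i j \<longleftrightarrow> (\<forall>n. cmod (p (n + 2 * 4 ^ j) - p (n + 2 * 4 ^ i)) \<le> \<kappa> / 6)" for i j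
  obtain W where "W > 0" "\<And>s. \<exists>i j. s \<le> i \<and> i < j \<and> j < s + W \<and> good i j"
  proof -
    have "0 < \<kappa> / 6" using \<open>\<kappa> > 0\<close> by simp
    from trig_polynomial_increment[OF p this, of "\<lambda>i. 2 * 4 ^ i"] that show thesis
      unfolding good_def by blast
  qed
  from good_pairs_positive_density[OF this]
  obtain K where "K > 0" and K: "\<forall>S. \<exists>G \<subseteq> {1..<K * Suc S}. card G = S \<and>
      (\<forall>m\<in>G. good (pair_fst m) (pair_snd m))"
    by blast
  let ?x = "\<lambda>n. cmod (?a (far_time n) - \<psi> (far_time n))"
  \<comment> \<open>The correlation jumps by \<open>\<kappa>\<close> between the two times of a good pair, whereas \<open>\<psi>\<close> moves by
      at most \<open>\<kappa>/6\<close> together with twice the error \<open>\<kappa>/6\<close> of its approximation; the remaining \<open>\<kappa>/2\<close> must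
      be a discrepancy between the two.\<close>
  have far: "\<kappa> / 2 \<le> ?x (2 * m) + ?x (2 * m + 1)" if "good (pair_fst m) (pair_snd m)" for m
  proof -
    let ?u = "far_time (2 * m)" and ?v = "far_time (2 * m + 1)"
    have le: "(2::nat) * 4 ^ pair_fst m \<le> 4 ^ (m + 2)"
    proof -
      have "(4::nat) ^ pair_fst m \<le> 4 ^ (m + 1)"
        using pair_fst_less_snd[of m] pair_snd_le[of m] by (intro power_increasing) auto
      then show ?thesis by simp
    qed
    have "cmod (p ?v - p ?u) \<le> \<kappa> / 6"
    proof -
      obtain n where u: "?u = n + 2 * 4 ^ pair_fst m"
        using le unfolding far_time_even by (metis le_add_diff_inverse2)
      then have v: "?v = n + 2 * 4 ^ pair_snd m"
        using far_time_odd[of m] unfolding far_time_even by linarith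
      show ?thesis unfolding u v using that by (simp only: good_def)
    qed
    moreover have "cmod (p ?u - \<psi> ?u) < \<kappa> / 6" "cmod (p ?v - \<psi> ?v) < \<kappa> / 6"
      by (rule approx[OF pos])+
    moreover have "\<kappa> = cmod (?a ?u - ?a ?v)"
      unfolding cantor_fourier_even cantor_fourier_odd by (simp add: \<kappa>_def)
    moreover have "cmod (?a ?u - ?a ?v) \<le> ?x (2 * m) + ?x (2 * m + 1) +
        (cmod (p ?u - \<psi> ?u) + cmod (p ?v - p ?u) + cmod (p ?v - \<psi> ?v))"
    proof -
      have "?a ?u - ?a ?v = (?a ?u - \<psi> ?u) - (?a ?v - \<psi> ?v) + (- (p ?u - \<psi> ?u) - (p ?v - p ?u) + (p ?v - \<psi> ?v))"
        by simp
      then show ?thesis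
        by (simp only: norm_triangle_six)
    qed
    ultimately show ?thesis by linarith
  qed
  show "0 < liminf (\<lambda>N. ereal (1 / real N * (\<Sum>n=1..N. ?x n)))"
  proof (rule liminf_average_pos[of ?x "\<kappa> / 2" K])
    show "\<forall>S. \<exists>G \<subseteq> {1..<K * Suc S}. card G = S \<and> (\<forall>m\<in>G. \<kappa> / 2 \<le> ?x (2 * m) + ?x (2 * m + 1))"
    proof
      fix S
      from K obtain G where "G \<subseteq> {1..<K * Suc S}" "card G = S"
        "\<forall>m\<in>G. good (pair_fst m) (pair_snd m)" by blast
      with far have "G \<subseteq> {1..<K * Suc S} \<and> card G = S \<and> (\<forall>m\<in>G. \<kappa> / 2 \<le> ?x (2 * m) + ?x (2 * m + 1))"
        by simp
      then show "\<exists>G \<subseteq> {1..<K * Suc S}. card G = S \<and> (\<forall>m\<in>G. \<kappa> / 2 \<le> ?x (2 * m) + ?x (2 * m + 1))" ..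
    qed
    show "0 < \<kappa> / 2" using \<open>\<kappa> > 0\<close> by simp
  qed (rule norm_ge_zero, fact)
qed

end
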